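(* Let $q$ be a complex number with $0<|q|<1$, fix a choice of $q^{1/8}$, and interpret every power $q^{k/8}$ ($k\in\mathbb{Z}$) as $(q^{1/8})^k$. Put $$P=\frac{q^{1/4}f(-q)f(-q^{12})}{f(-q^{3})f(-q^{4})},\qquad Q=\frac{q^{3/4}f(-q^{3})f(-q^{36})}{f(-q^{9})f(-q^{12})}.$$ Then $$\left(\frac{1}{PQ}+PQ\right)^2=\left(\frac{P}{Q}+\frac{Q}{P}\right)^2\left(\frac{1}{PQ}+PQ+1\right)+4.$$
   Context: For $|x|<1$, $f(-x):=(x;x)_\infty=\prod_{n=1}^{\infty}(1-x^n)$, where $(a;x)_\infty=\prod_{n\ge 0}(1-ax^n)$. *)

theory Defs
  imports "HOL-Analysis.Analysis"
begin

definition qpochhammer_inf :: "complex \<Rightarrow> complex \<Rightarrow> complex" where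
  "qpochhammer_inf a x = (\<Prod>n. 1 - a * x ^ n)"

(* Ramanujan's f(-x) = (x;x)_infinity is a function of -x, so ramanujan_f takes the
   negated nome: ramanujan_f (-x) = qpochhammer_inf x x.  Meaningful for norm x < 1. *)
definition ramanujan_f :: "complex \<Rightarrow> complex" where
  "ramanujan_f y = qpochhammer_inf (- y) (- y)"

lemma ramanujan_f_minus: "ramanujan_f (- x) = (\<Prod>n. 1 - x ^ Suc n)"
  by (simp add: ramanujan_f_def qpochhammer_inf_def)

end

theory Submission
  imports Defs "HOL-Library.Nat_Bijection"
begin

text \<open>
  Write \<open>E(n)\<close> for the infinite product \<open>(q\<^sup>n; q\<^sup>n)\<close>, \<open>\<phi>(-q) = E(1)\<^sup>2 / E(2)\<close> and
  \<open>\<psi>(q) = E(2)\<^sup>2 / E(1)\<close>. Splitting the theta series of \<open>\<phi>\<close> and \<open>\<psi>\<close> according to the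
  residue of the summation index modulo 3 and evaluating the pieces by the Jacobi triple product
  shows that, for one and the same quotient \<open>y(q) = q E(3) E(18)\<^sup>3 / (E(6) E(9)\<^sup>3)\<close>,
  both \<open>\<phi>(-q) / \<phi>(-q\<^sup>9) = 1 - 2 y\<close> and \<open>\<psi>(q) / (q \<psi>(q\<^sup>9)) = 1 + 1 / y\<close>.
  Multiplying over \<open>q, \<omega> q, \<omega>\<^sup>2 q\<close> with \<open>\<omega>\<close> a primitive cube root of unity
  gives \<open>\<phi>(-q\<^sup>3)\<^sup>4 / \<phi>(-q\<^sup>9)\<^sup>4 = 1 - 8 y\<^sup>3\<close> and
  \<open>\<psi>(q\<^sup>3)\<^sup>4 / (q\<^sup>3 \<psi>(q\<^sup>9)\<^sup>4) = 1 + 1 / y\<^sup>3\<close>.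
  With \<open>x = - y(-q)\<close> this makes \<open>P Q\<close> and \<open>Q\<^sup>4\<close> rational functions of \<open>x\<close> and \<open>y\<close>.
  Since \<open>x y = y(q\<^sup>2)\<close>, the product formula \<open>\<phi>(q) \<phi>(-q) = \<phi>(-q\<^sup>2)\<^sup>2\<close> says that \<open>(x, y)\<close>
  lies on the curve \<open>x - y = 2 x\<^sup>2 y\<^sup>2\<close>, and the theorem is a polynomial identity on this curve.
\<close>

section \<open>Dissection of infinite products\<close>

lemma convergent_prod_qpochhammer:
  assumes "norm x < 1"
  shows "convergent_prod (\<lambda>n. 1 - a * x ^ n :: complex)"
proof -
  have "summable (\<lambda>n. norm (a * x ^ n))"
    using assms by (simp add: norm_mult norm_power summable_mult summable_geometric)
  then show ?thesis
    by (intro abs_convergent_prod_imp_convergent_prod) (simp add: abs_convergent_prod_conv_summable)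
qed

lemma qpochhammer_LIMSEQ:
  assumes "norm x < 1"
  shows "(\<lambda>n. \<Prod>i<n. 1 - a * x ^ i) \<longlonglongrightarrow> qpochhammer_inf a x"
  using convergent_prod_LIMSEQ[OF convergent_prod_qpochhammer[OF assms, of a]]
  unfolding qpochhammer_inf_def by (subst (asm) lessThan_Suc_atMost[symmetric]) (rule LIMSEQ_imp_Suc)

lemma qpochhammer_nonzero:
  assumes "norm x < 1" "norm a < 1"
  shows "qpochhammer_inf a x \<noteq> 0"
  unfolding qpochhammer_inf_def
proof (rule prodinf_nonzero)
  show "convergent_prod (\<lambda>n. 1 - a * x ^ n)" by (rule convergent_prod_qpochhammer) fact
  fix n
  have "norm (a * x ^ n) \<le> norm a * 1"
    unfolding norm_mult norm_power using assms by (intro mult_left_mono power_le_one) auto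
  with assms(2) have "norm (a * x ^ n) < 1" by linarith
  then show "1 - a * x ^ n \<noteq> 0" by auto
qed

text \<open>Grouping the first \<open>n * k\<close> factors into blocks of length \<open>k\<close>
  makes both sides limits of the same finite products, the left one along the subsequence
  \<open>n * k\<close>.\<close>

lemma qpochhammer_dissect:
  assumes "norm x < 1" "k > 0"
  shows "qpochhammer_inf a x = (\<Prod>i<k. qpochhammer_inf (a * x ^ i) (x ^ k))"
proof (rule LIMSEQ_unique)
  have "filterlim (\<lambda>n. n * k) sequentially sequentially"
    using assms(2) by (rule mult_nat_right_at_top)
  then show "(\<lambda>n. \<Prod>i<n * k. 1 - a * x ^ i) \<longlonglongrightarrow> qpochhammer_inf a x"
    by (rule filterlim_compose[OF qpochhammer_LIMSEQ[OF assms(1)]])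
  have "norm (x ^ k) < 1" using assms by (simp add: norm_power power_less_one_iff)
  then have "(\<lambda>n. \<Prod>i<k. \<Prod>j<n. 1 - (a * x ^ i) * (x ^ k) ^ j)
      \<longlonglongrightarrow> (\<Prod>i<k. qpochhammer_inf (a * x ^ i) (x ^ k))"
    by (intro tendsto_prod qpochhammer_LIMSEQ)
  moreover have "(\<Prod>i<k. \<Prod>j<n. 1 - (a * x ^ i) * (x ^ k) ^ j) = (\<Prod>i<n * k. 1 - a * x ^ i)" for n
  proof -
    have "(\<Prod>i<n * k. 1 - a * x ^ i) = (\<Prod>j<n. \<Prod>i\<in>{j * k..<j * k + k}. 1 - a * x ^ i)"
      by (rule prod.nat_group[symmetric])
    also have "\<dots> = (\<Prod>j<n. \<Prod>i<k. 1 - (a * x ^ i) * (x ^ k) ^ j)"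
    proof (rule prod.cong[OF refl])
      fix j
      show "(\<Prod>i\<in>{j * k..<j * k + k}. 1 - a * x ^ i) = (\<Prod>i<k. 1 - (a * x ^ i) * (x ^ k) ^ j)"
        by (rule prod.reindex_bij_witness[of _ "\<lambda>i. i + j * k" "\<lambda>i. i - j * k"])
           (auto simp: power_add[symmetric] power_mult[symmetric] mult.commute[of k] mult.assoc)
    qed
    finally show ?thesis by (subst prod.swap) simp
  qed
  ultimately show "(\<lambda>n. \<Prod>i<n * k. 1 - a * x ^ i)
      \<longlonglongrightarrow> (\<Prod>i<k. qpochhammer_inf (a * x ^ i) (x ^ k))" by simp
qed

lemma qpochhammer_mult_minus:
  assumes "norm x < 1"
  shows "qpochhammer_inf a x * qpochhammer_inf (- a) x = qpochhammer_inf (a ^ 2) (x ^ 2)"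
proof -
  have "(1 - a * x ^ n) * (1 - - a * x ^ n) = 1 - a ^ 2 * (x ^ 2) ^ n" for n
    by (simp add: algebra_simps power2_eq_square power_mult_distrib)
  then show ?thesis
    unfolding qpochhammer_inf_def
    by (subst prodinf_mult) (simp_all only: convergent_prod_qpochhammer[OF assms])
qed

text \<open>Factor by factor this is
  \<open>(1 - t) * (1 - w * t) * (1 - w ^ 2 * t) = 1 - t ^ 3\<close>, valid because \<open>w\<close>
  is a primitive cube root of unity.\<close>

lemma qpochhammer_mult_cube_roots:
  assumes "norm x < 1" and w: "1 + w + w ^ 2 = 0"
  shows "qpochhammer_inf a x * qpochhammer_inf (w * a) x * qpochhammer_inf (w ^ 2 * a) x
    = qpochhammer_inf (a ^ 3) (x ^ 3)"
proof -
  have w3: "w ^ 3 = 1" using w by algebra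
  have "(1 - t) * (1 - w * t) * (1 - w ^ 2 * t) = 1 - t ^ 3" for t
    using w by algebra
  from this[of "a * x ^ n" for n]
  have *: "(1 - a * x ^ n) * (1 - (w * a) * x ^ n) * (1 - (w ^ 2 * a) * x ^ n) = 1 - a ^ 3 * (x ^ 3) ^ n" for n
    by (simp add: mult.assoc power_mult_distrib power_mult[symmetric] mult.commute[of n])
  note c = convergent_prod_qpochhammer[OF assms(1)]
  show ?thesis
    unfolding qpochhammer_inf_def prodinf_mult[OF c c] prodinf_mult[OF convergent_prod_mult[OF c c] c]
    by (simp only: *)
qed

section \<open>The Jacobi triple product\<close>

text \<open>The exponent is nonnegative for every integer, so \<open>nat\<close> cuts nothing off
  and natural powers of \<open>q\<close> suffice in the theta series.\<close>

definition tri :: "int \<Rightarrow> nat" where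
  "tri n = nat (n * (n - 1) div 2)"

lemma of_nat_tri: "2 * int (tri n) = n * (n - 1)"
proof -
  have "n * (n - 1) \<ge> 0"
    by (cases "n \<ge> 1") (auto simp: mult_nonneg_nonneg mult_nonpos_nonpos)
  moreover have "even (n * (n - 1))" by simp
  ultimately show ?thesis by (simp add: tri_def)
qed

lemma two_choose_two: "2 * int (n choose 2) = int n * (int n - 1)"
  by (induction n) (simp_all add: numeral_2_eq_2 algebra_simps)

section \<open>Gaussian binomial coefficients and the finite triple product\<close>

definition qfact :: "complex \<Rightarrow> nat \<Rightarrow> complex" where
  "qfact q n = (\<Prod>i<n. 1 - q ^ Suc i)"

text \<open>The Gaussian binomial coefficient as a quotient, so that bounds and limits can be read
  off from \<open>qfact\<close>.\<close>

definition qbinom :: "complex \<Rightarrow> nat \<Rightarrow> nat \<Rightarrow> complex" where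
  "qbinom q n k = (if k \<le> n then qfact q n / (qfact q k * qfact q (n - k)) else 0)"

lemma qfact_0 [simp]: "qfact q 0 = 1"
  by (simp add: qfact_def)

lemma qfact_Suc: "qfact q (Suc n) = qfact q n * (1 - q ^ Suc n)"
  by (simp add: qfact_def)

lemma one_minus_power_Suc_nonzero:
  fixes q :: complex
  assumes "norm q < 1"
  shows "1 - q ^ Suc n \<noteq> 0"
proof
  assume "1 - q ^ Suc n = 0"
  then have "norm q ^ Suc n = 1" by (metis eq_iff_diff_eq_0 norm_one norm_power)
  moreover have "norm q ^ Suc n < 1" using assms by (intro power_less_one_iff[THEN iffD2]) auto
  ultimately show False by simp
qed

lemma qfact_nonzero: "norm q < 1 \<Longrightarrow> qfact q n \<noteq> 0"
  using one_minus_power_Suc_nonzero unfolding qfact_def by (simp del: power_Suc)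

lemma qbinom_0: "norm q < 1 \<Longrightarrow> qbinom q n 0 = 1"
  by (simp add: qbinom_def qfact_nonzero)

lemma qbinom_gt: "k > n \<Longrightarrow> qbinom q n k = 0"
  by (simp add: qbinom_def)

text \<open>The q-Pascal rule. For \<open>n = k + m + 1\<close> it comes from splitting
  \<open>1 - q ^ Suc n\<close> as
  \<open>(1 - q ^ Suc k) + q ^ Suc k * (1 - q ^ Suc m)\<close>.\<close>

lemma qbinom_Suc:
  assumes "norm q < 1"
  shows "qbinom q (Suc n) (Suc k) = qbinom q n k + q ^ Suc k * qbinom q n (Suc k)"
proof -
  note [simp] = qfact_nonzero[OF assms] one_minus_power_Suc_nonzero[OF assms, simplified]
  consider "k < n" | "k = n" | "k > n" by linarith
  then show ?thesis
  proof cases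
    case 1
    then obtain m where n: "n = k + Suc m" by (metis less_iff_Suc_add add_Suc_right)
    have "1 - q ^ Suc n = (1 - q ^ Suc k) + q ^ Suc k * (1 - q ^ Suc m)"
      by (simp add: n power_add algebra_simps)
    moreover have "1 - q ^ Suc k \<noteq> 0" "1 - q ^ Suc m \<noteq> 0"
      by (rule one_minus_power_Suc_nonzero[OF assms])+
    ultimately show ?thesis
      unfolding qbinom_def n
      by (simp add: qfact_Suc divide_simps del: power_Suc) (simp add: algebra_simps del: power_Suc)
  next
    case 2
    then show ?thesis by (simp add: qbinom_def)
  next
    case 3
    then show ?thesis by (simp add: qbinom_def)
  qed
qed

text \<open>Peeling off the factor at \<open>i = 0\<close> replaces \<open>z\<close> by
  \<open>z * q\<close>, so the induction keeps \<open>z\<close> arbitrary; the q-Pascal rule then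
  recombines the coefficients.\<close>

lemma qbinomial_theorem:
  assumes "norm q < 1"
  shows "(\<Prod>i<n. 1 + z * q ^ i) = (\<Sum>k\<le>n. qbinom q n k * q ^ (k choose 2) * z ^ k)"
proof (induction n arbitrary: z)
  case 0
  then show ?case by (simp add: qbinom_0 assms numeral_2_eq_2)
next
  case (Suc n)
  let ?c = "\<lambda>k. qbinom q n k * q ^ (k choose 2) * q ^ k"
  have "(\<Prod>i<Suc n. 1 + z * q ^ i) = (1 + z) * (\<Prod>i<n. 1 + (z * q) * q ^ i)"
    by (simp add: prod.lessThan_Suc_shift mult.assoc del: prod.lessThan_Suc)
  also have "\<dots> = (1 + z) * (\<Sum>k\<le>n. ?c k * z ^ k)"
    by (subst Suc) (simp add: power_mult_distrib mult_ac)
  also have "\<dots> = (\<Sum>k\<le>Suc n. ?c k * z ^ k) + (\<Sum>k\<le>n. ?c k * z ^ Suc k)"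
    by (simp add: distrib_right sum_distrib_left sum.distrib mult_ac qbinom_gt)
  also have "\<dots> = qbinom q n 0 + (\<Sum>k\<le>n. (?c (Suc k) + ?c k) * z ^ Suc k)"
    by (subst sum.atMost_Suc_shift) (simp add: algebra_simps sum.distrib numeral_2_eq_2)
  also have "\<dots> = (\<Sum>k\<le>Suc n. qbinom q (Suc n) k * q ^ (k choose 2) * z ^ k)"
    by (subst sum.atMost_Suc_shift)
       (simp add: qbinom_Suc qbinom_0 assms numeral_2_eq_2 power_add algebra_simps)
  finally show ?case .
qed

text \<open>The q-binomial theorem for \<open>2 * n\<close> factors with \<open>z / q ^ n\<close> in
  place of \<open>z\<close>: the upper half of the factors is the first product, the lower half
  becomes the second after extracting a monomial.\<close>

lemma finite_triple_product:
  assumes q: "0 < norm q" "norm q < 1" and z: "z \<noteq> 0"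
  shows "(\<Prod>i<n. 1 + z * q ^ i) * (\<Prod>i<n. 1 + q ^ Suc i / z)
    = (\<Sum>j\<in>{- int n..int n}. qbinom q (2 * n) (nat (int n + j)) * q ^ tri j * z powi j)"
proof -
  have q0: "q \<noteq> 0" using q by auto
  \<comment> \<open>\<open>C\<close> is the reciprocal of the monomial extracted from the lower
    half.\<close>
  define C where "C = q ^ (Suc n choose 2) / z ^ n"
  have C: "C * (\<Prod>i<n. z / q ^ Suc i) = 1"
  proof -
    have "(\<Prod>i<n. q ^ Suc i) = q ^ (Suc n choose 2)"
      by (induction n) (simp_all add: numeral_2_eq_2 power_add mult_ac)
    then show ?thesis using q0 z by (simp add: C_def prod_dividef del: power_Suc)
  qed
  have "(\<Prod>i<2 * n. 1 + (z / q ^ n) * q ^ i) = (\<Prod>i<n. 1 + (z / q ^ n) * q ^ i) * (\<Prod>i<n. 1 + z * q ^ i)"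
  proof -
    have "{..<2 * n} = {..<n} \<union> {n..<2 * n}" by auto
    then have "(\<Prod>i<2 * n. 1 + (z / q ^ n) * q ^ i)
        = (\<Prod>i<n. 1 + (z / q ^ n) * q ^ i) * (\<Prod>i\<in>{n..<2 * n}. 1 + (z / q ^ n) * q ^ i)"
      by (simp add: prod.union_disjoint ivl_disj_int)
    also have "(\<Prod>i\<in>{n..<2 * n}. 1 + (z / q ^ n) * q ^ i) = (\<Prod>i<n. 1 + z * q ^ i)"
      by (rule prod.reindex_bij_witness[of _ "\<lambda>i. i + n" "\<lambda>i. i - n"])
         (auto simp: q0 power_diff)
    finally show ?thesis .
  qed
  \<comment> \<open>In reverse order the factors are \<open>1 + z / q ^ m\<close> with
    \<open>m\<close> from 1 to \<open>n\<close>, and each equals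
    \<open>(z / q ^ m) * (1 + q ^ m / z)\<close>.\<close>
  also have "(\<Prod>i<n. 1 + (z / q ^ n) * q ^ i) = (\<Prod>i<n. (z / q ^ Suc i) * (1 + q ^ Suc i / z))"
  proof (rule prod.reindex_bij_witness[of _ "\<lambda>i. n - Suc i" "\<lambda>i. n - Suc i"])
    fix i assume "i \<in> {..<n}"
    then have "q ^ n = q ^ i * q ^ Suc (n - Suc i)" by (simp flip: power_add power_Suc)
    then show "(z / q ^ Suc (n - Suc i)) * (1 + q ^ Suc (n - Suc i) / z) = 1 + (z / q ^ n) * q ^ i"
      using q0 z by (simp add: field_simps)
  qed auto
  also have "\<dots> = (\<Prod>i<n. z / q ^ Suc i) * (\<Prod>i<n. 1 + q ^ Suc i / z)"
    by (rule prod.distrib)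
  finally have "C * (\<Prod>i<2 * n. 1 + (z / q ^ n) * q ^ i)
      = (C * (\<Prod>i<n. z / q ^ Suc i)) * ((\<Prod>i<n. 1 + z * q ^ i) * (\<Prod>i<n. 1 + q ^ Suc i / z))"
    by (simp only: mult_ac)
  then have "(\<Prod>i<n. 1 + z * q ^ i) * (\<Prod>i<n. 1 + q ^ Suc i / z) = C * (\<Prod>i<2 * n. 1 + (z / q ^ n) * q ^ i)"
    by (simp only: C mult_1_left)
  also have "\<dots> = (\<Sum>k\<le>2 * n. C * (qbinom q (2 * n) k * q ^ (k choose 2) * (z / q ^ n) ^ k))"
    by (subst qbinomial_theorem[OF q(2)]) (simp add: sum_distrib_left)
  also have "\<dots> = (\<Sum>j\<in>{- int n..int n}. qbinom q (2 * n) (nat (int n + j)) * q ^ tri j * z powi j)"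
  proof (rule sum.reindex_bij_witness[of _ "\<lambda>j. nat (int n + j)" "\<lambda>k. int k - int n"])
    fix k assume "k \<in> {..2 * n}"
    \<comment> \<open>The shift \<open>j = k - n\<close> turns the binomial exponents into
      \<open>tri j\<close>; doubling avoids the division by 2.\<close>
    have "2 * int ((k choose 2) + (Suc n choose 2)) = 2 * int (tri (int k - int n) + n * k)"
      unfolding of_nat_add distrib_left two_choose_two of_nat_tri by (simp add: algebra_simps)
    then have "(k choose 2) + (Suc n choose 2) = tri (int k - int n) + n * k"
      by (simp only: mult_cancel_left of_nat_eq_iff) simp
    then have *: "q ^ (k choose 2) * q ^ (Suc n choose 2) = q ^ tri (int k - int n) * (q ^ n) ^ k"
      by (simp flip: power_add power_mult)
    have "C * (q ^ (k choose 2) * (z / q ^ n) ^ k)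
        = (q ^ (k choose 2) * q ^ (Suc n choose 2)) / (q ^ n) ^ k * (z ^ k / z ^ n)"
      by (simp add: C_def power_divide mult_ac)
    also have "\<dots> = q ^ tri (int k - int n) * z powi (int k - int n)"
      unfolding * using q0 z by (simp add: power_int_diff)
    finally show "qbinom q (2 * n) (nat (int n + (int k - int n))) * q ^ tri (int k - int n) * z powi (int k - int n)
        = C * (qbinom q (2 * n) k * q ^ (k choose 2) * (z / q ^ n) ^ k)"
      by (simp add: mult_ac)
  qed auto
  finally show ?thesis .
qed

section \<open>Domination and the passage to the infinite triple product\<close>

lemma summable_power_choose_two:
  fixes r c :: real
  assumes "0 \<le> r" "r < 1" "0 \<le> c"
  shows "summable (\<lambda>n. r ^ (n choose 2) * c ^ n)"
proof -
  \<comment> \<open>Passing from one term to the next multiplies it by \<open>r ^ n * c\<close>,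
    which tends to 0.\<close>
  have "(\<lambda>n. r ^ n * c) \<longlonglongrightarrow> 0 * c"
    using assms by (intro tendsto_mult tendsto_const LIMSEQ_realpow_zero)
  then have "eventually (\<lambda>n. r ^ n * c < 1/2) sequentially"
    by (rule order_tendstoD) simp
  then obtain N where N: "\<And>n. n \<ge> N \<Longrightarrow> r ^ n * c < 1/2"
    unfolding eventually_sequentially by blast
  show ?thesis
  proof (rule summable_ratio_test[of "1/2" N])
    fix n assume "n \<ge> N"
    then have "r ^ n * c * (r ^ (n choose 2) * c ^ n) \<le> 1/2 * (r ^ (n choose 2) * c ^ n)"
      using assms by (intro mult_right_mono less_imp_le[OF N]) auto
    then show "norm (r ^ (Suc n choose 2) * c ^ Suc n) \<le> 1/2 * norm (r ^ (n choose 2) * c ^ n)"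
      using assms by (simp add: numeral_2_eq_2 power_add mult_ac)
  qed simp
qed

lemma tri_int: "tri (int n) = n choose 2" and tri_minus_int: "tri (- int n) = (n choose 2) + n"
proof -
  have "2 * int (tri (int n)) = 2 * int (n choose 2)"
    unfolding of_nat_tri two_choose_two ..
  then show "tri (int n) = n choose 2" by simp
  have "2 * int (tri (- int n)) = 2 * int ((n choose 2) + n)"
    unfolding of_nat_tri of_nat_add distrib_left two_choose_two by (simp add: algebra_simps)
  then show "tri (- int n) = (n choose 2) + n"
    by (simp only: mult_cancel_left of_nat_eq_iff) simp
qed

text \<open>Each half of the integers gives a series with terms
  \<open>r ^ (n choose 2) * c ^ n\<close>, where \<open>r\<close> is \<open>norm q\<close> and
  \<open>c\<close> is \<open>norm z\<close> on the nonnegative side, \<open>norm q / norm z\<close>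
  on the other.\<close>

lemma abs_summable_theta:
  fixes q z :: complex
  assumes "norm q < 1"
  shows "(\<lambda>j. norm (q ^ tri j * z powi j)) summable_on UNIV"
proof -
  let ?f = "\<lambda>j. norm (q ^ tri j * z powi j)"
  have "summable (?f \<circ> int)"
    using summable_power_choose_two[of "norm q" "norm z"] assms
    by (simp add: o_def tri_int norm_mult norm_power)
  then have 1: "?f summable_on range int"
    by (subst summable_on_reindex) (auto intro!: norm_summable_imp_summable_on simp: o_def)
  have "summable (?f \<circ> (\<lambda>n. - int n))"
    using summable_power_choose_two[of "norm q" "norm q / norm z"] assms
    by (simp add: o_def tri_minus_int norm_mult norm_power norm_inverse power_add power_int_minus
      power_divide divide_inverse power_mult_distrib power_inverse mult_ac)
  then have 2: "?f summable_on range (\<lambda>n. - int n)"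
    by (subst summable_on_reindex) (auto intro!: norm_summable_imp_summable_on simp: o_def inj_on_def)
  have "j \<in> range int \<union> range (\<lambda>n. - int n)" for j
    by (cases j rule: int_cases2) auto
  then have "(UNIV :: int set) = range int \<union> range (\<lambda>n. - int n)" by blast
  with summable_on_union[OF 1 2] show ?thesis by simp
qed

text \<open>Ramanujan's theta function f(a, b) in product form, with a = \<open>z\<close> and b =
  \<open>q / z\<close>.\<close>

definition theta_prod :: "complex \<Rightarrow> complex \<Rightarrow> complex" where
  "theta_prod z q = qpochhammer_inf q q * qpochhammer_inf (- z) q * qpochhammer_inf (- (q / z)) q"

lemma qfact_LIMSEQ: "norm q < 1 \<Longrightarrow> qfact q \<longlonglongrightarrow> qpochhammer_inf q q"
  using qpochhammer_LIMSEQ[of q q] by (simp add: qfact_def[abs_def])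

text \<open>\<open>qfact q\<close> and its reciprocal both converge, hence are bounded. The uniform
  \<open>K\<close> provides the dominating series for Tannery's theorem.\<close>

lemma qbinom_bounded:
  assumes "norm q < 1"
  shows "\<exists>K. \<forall>n k. norm (qbinom q n k) \<le> K"
proof -
  have "Bseq (qfact q)"
    using qfact_LIMSEQ[OF assms] by (intro convergent_imp_Bseq convergentI)
  then obtain B where B: "B > 0" "\<And>n. norm (qfact q n) \<le> B" by (auto simp: Bseq_def)
  have "(\<lambda>n. inverse (qfact q n)) \<longlonglongrightarrow> inverse (qpochhammer_inf q q)"
    by (intro tendsto_inverse qfact_LIMSEQ qpochhammer_nonzero assms)
  then have "Bseq (\<lambda>n. inverse (qfact q n))"
    by (intro convergent_imp_Bseq convergentI)
  then obtain D where D: "D > 0" "\<And>n. norm (inverse (qfact q n)) \<le> D" by (auto simp: Bseq_def)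
  have "norm (qbinom q n k) \<le> B * (D * D)" for n k
  proof (cases "k \<le> n")
    case True
    have "norm (qbinom q n k) = norm (qfact q n) * (norm (inverse (qfact q k)) * norm (inverse (qfact q (n - k))))"
      using True by (simp add: qbinom_def norm_divide norm_mult norm_inverse divide_simps)
    also have "\<dots> \<le> B * (D * D)"
      using B D by (intro mult_mono) auto
    finally show ?thesis .
  next
    case False
    then show ?thesis using B D by (simp add: qbinom_def)
  qed
  then show ?thesis by blast
qed

lemma qbinom_central_LIMSEQ:
  assumes "norm q < 1"
  shows "(\<lambda>n. qbinom q (2 * n) (nat (int n + j))) \<longlonglongrightarrow> 1 / qpochhammer_inf q q"
proof -
  let ?E = "qpochhammer_inf q q"
  have E: "?E \<noteq> 0" by (rule qpochhammer_nonzero) fact+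
  have lim: "filterlim (\<lambda>n. nat (int n + i)) sequentially sequentially" for i
    unfolding filterlim_at_top
  proof
    fix N
    show "eventually (\<lambda>n. N \<le> nat (int n + i)) sequentially"
      using eventually_ge_at_top[of "N + nat \<bar>i\<bar>"] by eventually_elim linarith
  qed
  have lim2: "filterlim (\<lambda>n::nat. 2 * n) sequentially sequentially"
    by (rule mult_nat_left_at_top) simp
  have "(\<lambda>n. qfact q (2 * n) / (qfact q (nat (int n + j)) * qfact q (nat (int n + - j))))
      \<longlonglongrightarrow> ?E / (?E * ?E)"
    using E by (intro tendsto_divide tendsto_mult filterlim_compose[OF qfact_LIMSEQ[OF assms]] lim lim2) auto
  moreover have "eventually (\<lambda>n. qfact q (2 * n) / (qfact q (nat (int n + j)) * qfact q (nat (int n + - j)))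
      = qbinom q (2 * n) (nat (int n + j))) sequentially"
    using eventually_ge_at_top[of "nat \<bar>j\<bar>"]
  proof eventually_elim
    case (elim n)
    then have "nat (int n + j) \<le> 2 * n" "2 * n - nat (int n + j) = nat (int n + - j)" by linarith+
    then show ?case by (simp add: qbinom_def)
  qed
  ultimately show ?thesis
    using E by (simp add: tendsto_cong)
qed

text \<open>Let \<open>n\<close> grow in the finite version: each coefficient tends to
  \<open>1 / qpochhammer_inf q q\<close>, and Tannery's theorem interchanges limit and sum.\<close>

theorem jacobi_triple_product:
  assumes q: "0 < norm q" "norm q < 1" and z: "z \<noteq> 0"
  shows "((\<lambda>j. q ^ tri j * z powi j) has_sum theta_prod z q) UNIV"
proof -
  let ?E = "qpochhammer_inf q q"
  let ?t = "\<lambda>j. q ^ tri j * z powi j"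
  \<comment> \<open>The \<open>n\<close>-th finite identity, padded with zeros to a series over the
    naturals by enumerating the integers with \<open>int_decode\<close>.\<close>
  define a where "a = (\<lambda>k n. (if int_decode k \<in> {- int n..int n}
      then qbinom q (2 * n) (nat (int n + int_decode k)) * ?t (int_decode k) else 0))"
  obtain K where K: "\<And>n k. norm (qbinom q n k) \<le> K" using qbinom_bounded[OF q(2)] by blast
  have K0: "K \<ge> 0" using K[of 0 0] norm_ge_zero order_trans by blast
  have "(\<lambda>k. norm (?t (int_decode k))) summable_on UNIV"
    using abs_summable_theta[OF q(2), of z]
    by (subst (asm) summable_on_reindex_bij_betw[OF bij_int_decode, symmetric])
  then have M: "summable (\<lambda>k. norm (?t (int_decode k)))"
    by (rule summable_on_imp_summable)
  have lim: "(\<lambda>n. a k n) \<longlonglongrightarrow> 1 / ?E * ?t (int_decode k)" for k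
  proof -
    have "eventually (\<lambda>n. qbinom q (2 * n) (nat (int n + int_decode k)) * ?t (int_decode k) = a k n) sequentially"
      using eventually_ge_at_top[of "nat \<bar>int_decode k\<bar>"] by eventually_elim (auto simp: a_def)
    moreover have "(\<lambda>n. qbinom q (2 * n) (nat (int n + int_decode k)) * ?t (int_decode k))
        \<longlonglongrightarrow> 1 / ?E * ?t (int_decode k)"
      by (intro tendsto_mult_right qbinom_central_LIMSEQ q)
    ultimately show ?thesis by (simp add: tendsto_cong)
  qed
  have "norm (a k n) \<le> K * norm (?t (int_decode k))" for k n
    using K K0 by (auto simp: a_def norm_mult intro!: mult_right_mono)
  then have "eventually (\<lambda>n. summable (\<lambda>k. norm (a k n))) sequentially \<and>
      summable (\<lambda>k. norm (1 / ?E * ?t (int_decode k))) \<and>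
      (\<lambda>n. suminf (\<lambda>k. a k n)) \<longlonglongrightarrow> suminf (\<lambda>k. 1 / ?E * ?t (int_decode k))"
    by (intro tannerys_theorem[where M = "\<lambda>k. K * norm (?t (int_decode k))"] lim
          summable_mult[OF M] always_eventually trivial_limit_sequentially) auto
  then have lim_sum: "(\<lambda>n. suminf (\<lambda>k. a k n)) \<longlonglongrightarrow> suminf (\<lambda>k. 1 / ?E * ?t (int_decode k))"
    by blast
  have suminf_a: "suminf (\<lambda>k. a k n) = (\<Prod>i<n. 1 + z * q ^ i) * (\<Prod>i<n. 1 + q ^ Suc i / z)" for n
  proof -
    have "suminf (\<lambda>k. a k n) = (\<Sum>k\<in>int_encode ` {- int n..int n}. a k n)"
    proof (rule suminf_finite)
      fix k assume "k \<notin> int_encode ` {- int n..int n}"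
      then have "int_decode k \<notin> {- int n..int n}"
        by (metis imageI int_decode_inverse)
      then show "a k n = 0" by (simp only: a_def if_False)
    qed simp
    also have "\<dots> = (\<Sum>j\<in>{- int n..int n}. qbinom q (2 * n) (nat (int n + j)) * q ^ tri j * z powi j)"
      by (subst sum.reindex) (auto simp: a_def inj_int_encode mult.assoc)
    finally show ?thesis by (simp only: finite_triple_product[OF q z])
  qed
  have "(\<lambda>n. (\<Prod>i<n. 1 - (- z) * q ^ i) * (\<Prod>i<n. 1 - (- (q / z)) * q ^ i))
      \<longlonglongrightarrow> qpochhammer_inf (- z) q * qpochhammer_inf (- (q / z)) q"
    by (intro tendsto_mult qpochhammer_LIMSEQ q)
  then have "(\<lambda>n. suminf (\<lambda>k. a k n)) \<longlonglongrightarrow> qpochhammer_inf (- z) q * qpochhammer_inf (- (q / z)) q"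
    by (simp add: suminf_a)
  from LIMSEQ_unique[OF lim_sum this]
  have "1 / ?E * suminf (\<lambda>k. ?t (int_decode k)) = qpochhammer_inf (- z) q * qpochhammer_inf (- (q / z)) q"
    using summable_norm_cancel[OF M] by (simp only: suminf_mult)
  moreover have "?E \<noteq> 0" by (rule qpochhammer_nonzero) fact+
  ultimately have "suminf (\<lambda>k. ?t (int_decode k)) = theta_prod z q"
    by (simp add: theta_prod_def field_simps)
  then have "(\<lambda>k. ?t (int_decode k)) sums theta_prod z q"
    using summable_sums[OF summable_norm_cancel[OF M]] by simp
  then have "((\<lambda>k. ?t (int_decode k)) has_sum theta_prod z q) UNIV"
    by (rule norm_summable_imp_has_sum[OF M])
  then show ?thesis
    by (subst has_sum_reindex_bij_betw[OF bij_int_decode, symmetric])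
qed

section \<open>Cubic dissection of theta functions\<close>

text \<open>Because \<open>tri (3 * m + r) = tri r + 9 * tri m + (3 + 3 * r) * m\<close>, a residue
  class modulo 3 carries again a theta series, with base \<open>q ^ 9\<close>.\<close>

lemma has_sum_theta_residue:
  assumes q: "0 < norm q" "norm q < 1" and z: "z \<noteq> 0"
  shows "((\<lambda>j. q ^ tri j * z powi j) has_sum
    (q ^ tri r * z powi r * theta_prod (z ^ 3 * q powi (3 + 3 * r)) (q ^ 9))) (range (\<lambda>m. 3 * m + r))"
proof -
  have q0: "q \<noteq> 0" using q by auto
  let ?w = "z ^ 3 * q powi (3 + 3 * r)"
  have "((\<lambda>m. (q ^ 9) ^ tri m * ?w powi m) has_sum theta_prod ?w (q ^ 9)) UNIV"
    using q z q0 by (intro jacobi_triple_product) (auto simp: norm_power power_less_one_iff)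
  from has_sum_cmult_right[OF this, of "q ^ tri r * z powi r"]
  have "((\<lambda>m. q ^ tri r * z powi r * ((q ^ 9) ^ tri m * ?w powi m)) has_sum
      (q ^ tri r * z powi r * theta_prod ?w (q ^ 9))) UNIV" .
  moreover have "q ^ tri r * z powi r * ((q ^ 9) ^ tri m * ?w powi m)
      = q ^ tri (3 * m + r) * z powi (3 * m + r)" for m
  proof -
    have "2 * int (tri (3 * m + r)) = 2 * (int (tri r) + 9 * int (tri m) + (3 + 3 * r) * m)"
      using of_nat_tri[of "3 * m + r"] of_nat_tri[of r] of_nat_tri[of m] by (simp add: algebra_simps)
    then have tri: "int (tri (3 * m + r)) = int (tri r) + 9 * int (tri m) + (3 + 3 * r) * m" by simp
    have "q ^ tri (3 * m + r) = q powi int (tri (3 * m + r))" by simp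
    also have "\<dots> = q ^ tri r * (q ^ 9) ^ tri m * (q powi (3 + 3 * r)) powi m"
      unfolding tri using q0 by (simp add: power_int_add power_int_mult power_int_power')
    finally have 1: "q ^ tri (3 * m + r) = q ^ tri r * (q ^ 9) ^ tri m * (q powi (3 + 3 * r)) powi m" .
    have 2: "z powi (3 * m + r) = z powi r * (z ^ 3) powi m"
      using z by (simp add: power_int_add power_int_mult)
    show ?thesis
      unfolding 1 2 power_int_mult_distrib by (simp only: mult_ac)
  qed
  ultimately show ?thesis
    by (subst has_sum_reindex) (simp_all add: inj_on_def o_def)
qed

text \<open>The residues are represented by 0, 1 and -1; taking -1 instead of 2 makes the argument
  of the last piece simply \<open>z ^ 3\<close>.\<close>

lemma theta_prod_dissect:
  assumes q: "0 < norm q" "norm q < 1" and z: "z \<noteq> 0"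
  shows "theta_prod z q = theta_prod (z ^ 3 * q ^ 3) (q ^ 9) + z * theta_prod (z ^ 3 * q ^ 6) (q ^ 9)
    + q / z * theta_prod (z ^ 3) (q ^ 9)"
proof (rule has_sum_unique)
  let ?t = "\<lambda>j. q ^ tri j * z powi j"
  let ?A = "\<lambda>r::int. range (\<lambda>m. 3 * m + r)"
  show "(?t has_sum theta_prod z q) UNIV" by (intro jacobi_triple_product q z)
  have tri: "tri 0 = 0" "tri 1 = 0" "tri (- 1) = 1" by (simp_all add: tri_def)
  have UN: "UNIV = ?A 0 \<union> ?A 1 \<union> ?A (- 1)"
  proof -
    have "j \<in> ?A 0 \<union> ?A 1 \<union> ?A (- 1)" for j
    proof -
      have "j = 3 * (j div 3) + 0 \<or> j = 3 * (j div 3) + 1 \<or> j = 3 * (j div 3 + 1) + - 1" by presburger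
      then show ?thesis by blast
    qed
    then show ?thesis by blast
  qed
  have D: "?A 0 \<inter> ?A 1 = {}" "(?A 0 \<union> ?A 1) \<inter> ?A (- 1) = {}"
    by (auto, presburger+)
  show "(?t has_sum (theta_prod (z ^ 3 * q ^ 3) (q ^ 9) + z * theta_prod (z ^ 3 * q ^ 6) (q ^ 9)
    + q / z * theta_prod (z ^ 3) (q ^ 9))) UNIV"
    using has_sum_Un_disjoint[OF has_sum_Un_disjoint[OF has_sum_theta_residue[OF q z, of 0]
          has_sum_theta_residue[OF q z, of 1] D(1)] has_sum_theta_residue[OF q z, of "- 1"] D(2)]
    unfolding UN[symmetric] by (simp add: tri power_int_minus divide_inverse)
qed

section \<open>Euler products under sign change and under cube roots of unity\<close>

definition euler_fun :: "complex \<Rightarrow> complex" where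
  "euler_fun q = qpochhammer_inf q q"

lemma euler_fun_nonzero: "norm q < 1 \<Longrightarrow> euler_fun q \<noteq> 0"
  by (simp add: euler_fun_def qpochhammer_nonzero)

lemma norm_power_less_one:
  fixes q :: complex
  assumes "norm q < 1" "n > 0"
  shows "norm (q ^ n) < 1"
  using assms by (simp add: norm_power power_less_one_iff)

lemma euler_fun_dissect_2:
  assumes "norm q < 1"
  shows "euler_fun q = qpochhammer_inf q (q ^ 2) * euler_fun (q ^ 2)"
  using qpochhammer_dissect[OF assms, of 2 q]
  by (simp add: euler_fun_def lessThan_nat_numeral power2_eq_square power3_eq_cube mult_ac)

lemma euler_fun_dissect_3:
  assumes "norm q < 1"
  shows "euler_fun q = qpochhammer_inf q (q ^ 3) * qpochhammer_inf (q ^ 2) (q ^ 3) * euler_fun (q ^ 3)"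
  using qpochhammer_dissect[OF assms, of 3 q]
  by (simp add: euler_fun_def lessThan_nat_numeral power2_eq_square power3_eq_cube mult_ac)

text \<open>The odd factors for \<open>q\<close> and \<open>- q\<close> multiply to
  \<open>qpochhammer_inf (q ^ 2) (q ^ 4)\<close>. This later removes all arguments of the form
  \<open>- (q ^ n)\<close>.\<close>

lemma euler_fun_minus:
  assumes "norm q < 1"
  shows "euler_fun (- q) * euler_fun q * euler_fun (q ^ 4) = euler_fun (q ^ 2) ^ 3"
proof -
  have q2: "norm (q ^ 2) < 1" using assms by (rule norm_power_less_one) simp
  have "euler_fun (- q) = qpochhammer_inf (- q) (q ^ 2) * euler_fun (q ^ 2)"
    using euler_fun_dissect_2[of "- q"] assms by simp
  moreover note euler_fun_dissect_2[OF assms]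
  moreover have "euler_fun (q ^ 2) = qpochhammer_inf (q ^ 2) (q ^ 4) * euler_fun (q ^ 4)"
    using euler_fun_dissect_2[OF q2] by (simp flip: power_mult)
  moreover have "qpochhammer_inf q (q ^ 2) * qpochhammer_inf (- q) (q ^ 2) = qpochhammer_inf (q ^ 2) (q ^ 4)"
    using qpochhammer_mult_minus[OF q2, of q] by (simp flip: power_mult)
  ultimately show ?thesis by algebra
qed

text \<open>Exponents divisible by 3 do not see \<open>w\<close> and give
  \<open>euler_fun (q ^ 3) ^ 3\<close>; the other two classes collapse to the factors of
  \<open>euler_fun (q ^ 3)\<close> with exponents not divisible by 9.\<close>

lemma euler_fun_mult_cube_roots:
  assumes q: "norm q < 1" and w: "1 + w + w ^ 2 = 0"
  shows "euler_fun q * euler_fun (w * q) * euler_fun (w ^ 2 * q) * euler_fun (q ^ 9) = euler_fun (q ^ 3) ^ 4"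
proof -
  have w3: "w ^ 3 = 1" using w by algebra
  then have "norm w ^ 3 = 1" by (metis norm_one norm_power)
  then have nw: "norm w = 1" using power_eq_iff_eq_base[of 3 "norm w" 1] by simp
  have q3: "norm (q ^ 3) < 1" using q by (rule norm_power_less_one) simp
  let ?p = "\<lambda>a. qpochhammer_inf a (q ^ 3)"
  have w6: "(w ^ 2) ^ 3 = 1" and w4: "(w ^ 2) ^ 2 = w" using w3 by algebra+
  have 1: "euler_fun (w * q) = ?p (w * q) * ?p (w ^ 2 * q ^ 2) * euler_fun (q ^ 3)"
    using euler_fun_dissect_3[of "w * q"] q nw by (simp add: norm_mult power_mult_distrib w3)
  have 2: "euler_fun (w ^ 2 * q) = ?p (w ^ 2 * q) * ?p (w * q ^ 2) * euler_fun (q ^ 3)"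
    using euler_fun_dissect_3[of "w ^ 2 * q"] q nw
    by (simp only: norm_mult norm_power power_mult_distrib w6 w4) simp
  have 3: "?p a * ?p (w * a) * ?p (w ^ 2 * a) = qpochhammer_inf (a ^ 3) (q ^ 9)" for a
    using qpochhammer_mult_cube_roots[OF q3 w, of a] by (simp flip: power_mult)
  have 4: "euler_fun (q ^ 3) = qpochhammer_inf (q ^ 3) (q ^ 9) * qpochhammer_inf (q ^ 6) (q ^ 9) * euler_fun (q ^ 9)"
    using euler_fun_dissect_3[OF q3] by (simp flip: power_mult)
  have "euler_fun q * euler_fun (w * q) * euler_fun (w ^ 2 * q) * euler_fun (q ^ 9)
     = euler_fun (q ^ 3) ^ 3 * (?p q * ?p (w * q) * ?p (w ^ 2 * q))
        * (?p (q ^ 2) * ?p (w * q ^ 2) * ?p (w ^ 2 * q ^ 2)) * euler_fun (q ^ 9)"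
    unfolding 1 2 euler_fun_dissect_3[OF q] by algebra
  also have "\<dots> = euler_fun (q ^ 3) ^ 3 * (qpochhammer_inf (q ^ 3) (q ^ 9) * qpochhammer_inf (q ^ 6) (q ^ 9) * euler_fun (q ^ 9))"
    unfolding 3 by (simp flip: power_mult)
  also have "\<dots> = euler_fun (q ^ 3) ^ 4"
    unfolding 4[symmetric] by algebra
  finally show ?thesis .
qed

section \<open>Theta products as quotients of Euler products\<close>

lemma theta_prod_sym: "q \<noteq> 0 \<Longrightarrow> z \<noteq> 0 \<Longrightarrow> theta_prod (q / z) q = theta_prod z q"
  by (simp add: theta_prod_def)

text \<open>This theta product is phi(-q).\<close>

lemma theta_prod_phi:
  assumes q: "0 < norm q" "norm q < 1"
  shows "theta_prod (- q) (q ^ 2) * euler_fun (q ^ 2) = euler_fun q ^ 2"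
proof -
  have "q ^ 2 / q = q" using q by (auto simp: power2_eq_square)
  then show ?thesis
    unfolding euler_fun_dissect_2[OF q(2)]
    by (simp add: theta_prod_def euler_fun_def power2_eq_square)
qed

text \<open>This theta product is 2 psi(q); the 2 is the leading factor of
  \<open>qpochhammer_inf (- 1) q\<close>.\<close>

lemma theta_prod_psi:
  assumes q: "0 < norm q" "norm q < 1"
  shows "theta_prod 1 q * euler_fun q = 2 * euler_fun (q ^ 2) ^ 2"
proof -
  let ?m = "qpochhammer_inf (- q) q"
  have "qpochhammer_inf (- 1) q = 2 * ?m"
    using prodinf_split_head[OF convergent_prod_qpochhammer[OF q(2), of "- 1"]]
    unfolding qpochhammer_inf_def by (simp add: mult.commute[of 2])
  moreover have "euler_fun q * ?m = euler_fun (q ^ 2)"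
    using qpochhammer_mult_minus[OF q(2), of q] by (simp add: euler_fun_def)
  ultimately show ?thesis
    unfolding theta_prod_def euler_fun_def[symmetric] by simp algebra
qed

text \<open>Evaluates f(q, q^2), the piece shared by two residue classes of psi: it is
  \<open>qpochhammer_inf (- q) q\<close> without the exponents divisible by 3, up to an Euler
  product.\<close>

lemma theta_prod_psi_cubic:
  assumes q: "0 < norm q" "norm q < 1"
  shows "theta_prod q (q ^ 3) * (euler_fun q * euler_fun (q ^ 6)) = euler_fun (q ^ 2) * euler_fun (q ^ 3) ^ 2"
proof -
  let ?m = "\<lambda>n. qpochhammer_inf (- (q ^ n)) (q ^ 3)"
  have q3: "norm (q ^ 3) < 1" using q by (intro norm_power_less_one) auto
  have "q ^ 3 / q = q ^ 2" using q by (auto simp: power2_eq_square power3_eq_cube)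
  then have "theta_prod q (q ^ 3) = euler_fun (q ^ 3) * ?m 1 * ?m 2"
    by (simp add: theta_prod_def euler_fun_def)
  moreover have "qpochhammer_inf (- q) q = ?m 1 * ?m 2 * ?m 3"
    using qpochhammer_dissect[OF q(2), of 3 "- q"]
    by (simp add: lessThan_nat_numeral power2_eq_square power3_eq_cube mult_ac)
  moreover have "euler_fun q * qpochhammer_inf (- q) q = euler_fun (q ^ 2)"
    using qpochhammer_mult_minus[OF q(2), of q] by (simp add: euler_fun_def)
  moreover have "euler_fun (q ^ 3) * ?m 3 = euler_fun (q ^ 6)"
    using qpochhammer_mult_minus[OF q3, of "q ^ 3"] by (simp add: euler_fun_def flip: power_mult)
  ultimately show ?thesis by algebra
qed

text \<open>Evaluates f(-q, -q^5), the corresponding piece of phi, by sieving the exponents modulo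
  6.\<close>

lemma theta_prod_phi_cubic:
  assumes q: "0 < norm q" "norm q < 1"
  shows "theta_prod (- q) (q ^ 6) * (euler_fun (q ^ 2) * euler_fun (q ^ 3)) = euler_fun q * euler_fun (q ^ 6) ^ 2"
proof -
  let ?p = "\<lambda>n. qpochhammer_inf (q ^ n) (q ^ 6)"
  have q2: "norm (q ^ 2) < 1" and q3: "norm (q ^ 3) < 1" using q by (auto intro: norm_power_less_one)
  have "q ^ 6 / q = q ^ 5" using q by (auto simp: eval_nat_numeral)
  then have "theta_prod (- q) (q ^ 6) = euler_fun (q ^ 6) * ?p 1 * ?p 5"
    by (simp add: theta_prod_def euler_fun_def)
  moreover have "euler_fun q = ?p 1 * ?p 2 * ?p 3 * ?p 4 * ?p 5 * euler_fun (q ^ 6)"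
    using qpochhammer_dissect[OF q(2), of 6 q] unfolding euler_fun_def
    by (simp add: lessThan_nat_numeral power_Suc[symmetric] numeral_2_eq_2[symmetric] mult_ac del: power_Suc)
  moreover have "euler_fun (q ^ 2) = ?p 2 * ?p 4 * euler_fun (q ^ 6)"
    using euler_fun_dissect_3[OF q2] by (simp flip: power_mult)
  moreover have "euler_fun (q ^ 3) = ?p 3 * euler_fun (q ^ 6)"
    using euler_fun_dissect_2[OF q3] by (simp flip: power_mult)
  ultimately show ?thesis by algebra
qed

definition eta_quot :: "complex \<Rightarrow> complex" where
  "eta_quot q = q * euler_fun (q ^ 3) * euler_fun (q ^ 18) ^ 3 / (euler_fun (q ^ 6) * euler_fun (q ^ 9) ^ 3)"

text \<open>Apart from the leading \<open>q\<close>, only powers of \<open>q ^ 3\<close> enter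
  \<open>eta_quot\<close>.\<close>

lemma eta_quot_mult_cube_root:
  assumes "v ^ 3 = 1"
  shows "eta_quot (v * q) = v * eta_quot q"
proof -
  have "v ^ 6 = 1" "v ^ 9 = 1" "v ^ 18 = 1" using assms by algebra+
  then show ?thesis by (simp add: eta_quot_def power_mult_distrib assms)
qed

text \<open>Dissect with base \<open>q ^ 2\<close> at \<open>z = - q\<close>. The symmetry of
  \<open>theta_prod\<close> makes two of the three pieces equal, whence the coefficient 2.\<close>

lemma phi_dissect:
  assumes q: "0 < norm q" "norm q < 1"
  shows "euler_fun q ^ 2 / euler_fun (q ^ 2)
    = euler_fun (q ^ 9) ^ 2 / euler_fun (q ^ 18) * (1 - 2 * eta_quot q)"
proof -
  have q0: "q \<noteq> 0" using q by auto
  have nz: "euler_fun (q ^ n) \<noteq> 0" if "n > 0" for n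
    using q that by (intro euler_fun_nonzero norm_power_less_one)
  have n: "0 < norm (q ^ n)" "norm (q ^ n) < 1" if "n > 0" for n
    using q0 that norm_power_less_one[OF q(2)] by auto
  have "theta_prod (- q) (q ^ 2)
      = theta_prod (- (q ^ 9)) (q ^ 18) + (- q) * theta_prod (- (q ^ 15)) (q ^ 18) + - q * theta_prod (- (q ^ 3)) (q ^ 18)"
  proof -
    have "(- q) ^ 3 * (q ^ 2) ^ 3 = - (q ^ 9)" "(- q) ^ 3 * (q ^ 2) ^ 6 = - (q ^ 15)"
      "(- q) ^ 3 = - (q ^ 3)" "(q ^ 2) ^ 9 = q ^ 18" "q ^ 2 / - q = - q"
      using q0 by (simp_all flip: power_mult power_add) (simp add: power2_eq_square)
    with theta_prod_dissect[OF n(1)[of 2] n(2)[of 2], of "- q"] q0 show ?thesis by (simp only:) simp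
  qed
  also have "theta_prod (- (q ^ 15)) (q ^ 18) = theta_prod (- (q ^ 3)) (q ^ 18)"
    using theta_prod_sym[of "q ^ 18" "- (q ^ 3)"] q0 by (simp add: power_diff[symmetric])
  also have "theta_prod (- (q ^ 9)) (q ^ 18) = euler_fun (q ^ 9) ^ 2 / euler_fun (q ^ 18)"
    using theta_prod_phi[OF n[of 9]] nz[of 18] by (simp add: field_simps flip: power_mult)
  also have "theta_prod (- (q ^ 3)) (q ^ 18) = euler_fun (q ^ 3) * euler_fun (q ^ 18) ^ 2 / (euler_fun (q ^ 6) * euler_fun (q ^ 9))"
    using theta_prod_phi_cubic[OF n[of 3]] nz[of 6] nz[of 9] by (simp add: field_simps flip: power_mult)
  also have "theta_prod (- q) (q ^ 2) = euler_fun q ^ 2 / euler_fun (q ^ 2)"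
    using theta_prod_phi[OF q] nz[of 2] by (simp add: field_simps)
  also have "euler_fun (q ^ 9) ^ 2 / euler_fun (q ^ 18)
      + - q * (euler_fun (q ^ 3) * euler_fun (q ^ 18) ^ 2 / (euler_fun (q ^ 6) * euler_fun (q ^ 9)))
      + - q * (euler_fun (q ^ 3) * euler_fun (q ^ 18) ^ 2 / (euler_fun (q ^ 6) * euler_fun (q ^ 9)))
      = euler_fun (q ^ 9) ^ 2 / euler_fun (q ^ 18) * (1 - 2 * eta_quot q)"
    using nz[of 6] nz[of 9] nz[of 18] by (simp add: eta_quot_def divide_simps) algebra
  finally show ?thesis .
qed

text \<open>Dissect at \<open>z = 1\<close>. Two pieces agree by symmetry, so the factor 2 in 2 psi
  cancels throughout.\<close>

lemma psi_dissect:
  assumes q: "0 < norm q" "norm q < 1"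
  shows "euler_fun (q ^ 2) ^ 2 / euler_fun q
    = q * (euler_fun (q ^ 18) ^ 2 / euler_fun (q ^ 9)) * (1 + 1 / eta_quot q)"
proof -
  have q0: "q \<noteq> 0" using q by auto
  have nz: "euler_fun (q ^ n) \<noteq> 0" if "n > 0" for n
    using q that by (intro euler_fun_nonzero norm_power_less_one)
  have n: "0 < norm (q ^ n)" "norm (q ^ n) < 1" if "n > 0" for n
    using q0 that norm_power_less_one[OF q(2)] by auto
  have "theta_prod 1 q = theta_prod (q ^ 3) (q ^ 9) + theta_prod (q ^ 6) (q ^ 9) + q * theta_prod 1 (q ^ 9)"
    using theta_prod_dissect[OF q, of 1] by simp
  also have "theta_prod (q ^ 6) (q ^ 9) = theta_prod (q ^ 3) (q ^ 9)"
    using theta_prod_sym[of "q ^ 9" "q ^ 3"] q0 by (simp add: power_diff[symmetric])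
  also have "theta_prod (q ^ 3) (q ^ 9) = euler_fun (q ^ 6) * euler_fun (q ^ 9) ^ 2 / (euler_fun (q ^ 3) * euler_fun (q ^ 18))"
    using theta_prod_psi_cubic[OF n[of 3]] nz[of 3] nz[of 18] by (simp add: field_simps flip: power_mult)
  also have "theta_prod 1 q = 2 * (euler_fun (q ^ 2) ^ 2 / euler_fun q)"
    using theta_prod_psi[OF q] nz[of 1] by (simp add: field_simps)
  also have "theta_prod 1 (q ^ 9) = 2 * (euler_fun (q ^ 18) ^ 2 / euler_fun (q ^ 9))"
    using theta_prod_psi[OF n[of 9]] nz[of 9] by (simp add: field_simps flip: power_mult)
  finally have *: "2 * (euler_fun (q ^ 2) ^ 2 / euler_fun q)
      = euler_fun (q ^ 6) * euler_fun (q ^ 9) ^ 2 / (euler_fun (q ^ 3) * euler_fun (q ^ 18))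
        + euler_fun (q ^ 6) * euler_fun (q ^ 9) ^ 2 / (euler_fun (q ^ 3) * euler_fun (q ^ 18))
        + q * (2 * (euler_fun (q ^ 18) ^ 2 / euler_fun (q ^ 9)))" .
  have "a = b + q * c" if "2 * a = b + b + q * (2 * c)" for a b c :: complex
    using that by algebra
  from this[OF *] have "euler_fun (q ^ 2) ^ 2 / euler_fun q
      = euler_fun (q ^ 6) * euler_fun (q ^ 9) ^ 2 / (euler_fun (q ^ 3) * euler_fun (q ^ 18))
        + q * (euler_fun (q ^ 18) ^ 2 / euler_fun (q ^ 9))" .
  also have "\<dots> = q * (euler_fun (q ^ 18) ^ 2 / euler_fun (q ^ 9)) * (1 + 1 / eta_quot q)"
    using q0 nz[of 3] nz[of 6] nz[of 9] nz[of 18]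
    by (simp add: eta_quot_def divide_simps) algebra
  finally show ?thesis .
qed

section \<open>Cubic relations\<close>

lemma exists_primitive_cube_root: "\<exists>w::complex. 1 + w + w ^ 2 = 0"
proof
  have "(complex_of_real (sqrt 3)) ^ 2 = 3" by (simp flip: of_real_power)
  then show "1 + (- 1 + \<i> * sqrt 3) / 2 + ((- 1 + \<i> * sqrt 3) / 2) ^ 2 = (0::complex)"
    by (simp add: power2_eq_square field_simps)
qed

lemma phi_cubic:
  assumes q: "0 < norm q" "norm q < 1"
  shows "(euler_fun (q ^ 3) ^ 2 * euler_fun (q ^ 18) / (euler_fun (q ^ 6) * euler_fun (q ^ 9) ^ 2)) ^ 4
    = 1 - 8 * eta_quot q ^ 3"
proof -
  obtain w :: complex where w: "1 + w + w ^ 2 = 0" using exists_primitive_cube_root by blast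
  have w3: "w ^ 3 = 1" using w by algebra
  have nw: "norm w = 1"
    using power_eq_iff_eq_base[of 3 "norm w" 1] w3 by (simp flip: norm_power)
  have w2: "1 + w ^ 2 + (w ^ 2) ^ 2 = 0" using w by algebra
  have nz: "euler_fun (q ^ n) \<noteq> 0" if "n > 0" for n
    using q that by (intro euler_fun_nonzero norm_power_less_one)
  define A where "A = euler_fun (q ^ 9) ^ 2 / euler_fun (q ^ 18)"
  let ?y = "eta_quot q"
  \<comment> \<open>\<open>A\<close> involves only powers of \<open>q ^ 9\<close>, so replacing
    \<open>q\<close> by \<open>v * q\<close> changes nothing but \<open>?y\<close>.\<close>
  have A: "euler_fun (v * q) ^ 2 / euler_fun (v ^ 2 * q ^ 2) = A * (1 - 2 * (v * ?y))" 
    if "v ^ 3 = 1" "norm v = 1" for v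
  proof -
    have "v ^ 9 = 1" "v ^ 18 = 1" using that(1) by algebra+
    with phi_dissect[of "v * q"] q that show ?thesis
      by (simp add: eta_quot_mult_cube_root norm_mult power_mult_distrib A_def)
  qed
  have p1: "euler_fun q * euler_fun (w * q) * euler_fun (w ^ 2 * q) = euler_fun (q ^ 3) ^ 4 / euler_fun (q ^ 9)"
    using euler_fun_mult_cube_roots[OF q(2) w] nz[of 9] by (simp add: field_simps)
  \<comment> \<open>Squaring \<open>w * q\<close> turns the cube root into \<open>w ^ 2\<close>,
    again a primitive one.\<close>
  have p2: "euler_fun (q ^ 2) * euler_fun (w ^ 2 * q ^ 2) * euler_fun ((w ^ 2) ^ 2 * q ^ 2)
      = euler_fun (q ^ 6) ^ 4 / euler_fun (q ^ 18)"
    using euler_fun_mult_cube_roots[OF norm_power_less_one[OF q(2), of 2] w2] nz[of 18]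
    by (simp add: field_simps flip: power_mult)
  have "(euler_fun (q ^ 3) ^ 4 / euler_fun (q ^ 9)) ^ 2 / (euler_fun (q ^ 6) ^ 4 / euler_fun (q ^ 18))
    = (euler_fun q ^ 2 / euler_fun (q ^ 2)) * (euler_fun (w * q) ^ 2 / euler_fun (w ^ 2 * q ^ 2))
      * (euler_fun (w ^ 2 * q) ^ 2 / euler_fun ((w ^ 2) ^ 2 * q ^ 2))"
    unfolding p1[symmetric] p2[symmetric] by (simp only: power_mult_distrib times_divide_times_eq)
  also have "\<dots> = (A * (1 - 2 * ?y)) * (A * (1 - 2 * (w * ?y))) * (A * (1 - 2 * (w ^ 2 * ?y)))"
  proof -
    have "(w ^ 2) ^ 3 = 1" using w3 by algebra
    then show ?thesis
      using A[of 1] A[of w] A[of "w ^ 2"] w3 nw by (simp only: norm_power) simp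
  qed
  also have "\<dots> = A ^ 3 * (1 - 8 * ?y ^ 3)"
    using w w3 by algebra
  finally have "1 - 8 * ?y ^ 3
      = (euler_fun (q ^ 3) ^ 4 / euler_fun (q ^ 9)) ^ 2 / (euler_fun (q ^ 6) ^ 4 / euler_fun (q ^ 18)) / A ^ 3"
    using nz[of 9] nz[of 18] by (simp add: A_def)
  also have "\<dots> = (euler_fun (q ^ 3) ^ 2 * euler_fun (q ^ 18) / (euler_fun (q ^ 6) * euler_fun (q ^ 9) ^ 2)) ^ 4"
    using nz[of 6] nz[of 9] nz[of 18] unfolding A_def by (simp add: divide_simps) algebra
  finally show ?thesis by simp
qed

lemma psi_cubic:
  assumes q: "0 < norm q" "norm q < 1"
  shows "(euler_fun (q ^ 6) ^ 2 * euler_fun (q ^ 9) / (euler_fun (q ^ 3) * euler_fun (q ^ 18) ^ 2)) ^ 4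
    = q ^ 3 * (1 + 1 / eta_quot q ^ 3)"
proof -
  obtain w :: complex where w: "1 + w + w ^ 2 = 0" using exists_primitive_cube_root by blast
  have w3: "w ^ 3 = 1" using w by algebra
  have nw: "norm w = 1"
    using power_eq_iff_eq_base[of 3 "norm w" 1] w3 by (simp flip: norm_power)
  have w2: "1 + w ^ 2 + (w ^ 2) ^ 2 = 0" using w by algebra
  have q0: "q \<noteq> 0" using q by auto
  have nz: "euler_fun (q ^ n) \<noteq> 0" if "n > 0" for n
    using q that by (intro euler_fun_nonzero norm_power_less_one)
  define A where "A = euler_fun (q ^ 18) ^ 2 / euler_fun (q ^ 9)"
  let ?y = "eta_quot q"
  have y0: "?y \<noteq> 0" using q0 nz[of 3] nz[of 6] nz[of 9] nz[of 18] by (simp add: eta_quot_def)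
  \<comment> \<open>The factor \<open>v\<close> from the leading \<open>q\<close> cancels the one in
    \<open>1 / (v * ?y)\<close>.\<close>
  have A: "euler_fun (v ^ 2 * q ^ 2) ^ 2 / euler_fun (v * q) = q * A / ?y * (v * ?y + 1)"
    if "v ^ 3 = 1" "norm v = 1" for v
  proof -
    have v: "v ^ 9 = 1" "v ^ 18 = 1" using that(1) by algebra+
    have v0: "v \<noteq> 0" using that by auto
    have "euler_fun (v ^ 2 * q ^ 2) ^ 2 / euler_fun (v * q) = v * q * A * (1 + 1 / (v * ?y))"
      using psi_dissect[of "v * q"] q that v
      by (simp add: eta_quot_mult_cube_root norm_mult power_mult_distrib A_def)
    also have "\<dots> = q * A / ?y * (v * ?y + 1)" using v0 y0 by (simp add: field_simps)
    finally show ?thesis .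
  qed
  have p1: "euler_fun q * euler_fun (w * q) * euler_fun (w ^ 2 * q) = euler_fun (q ^ 3) ^ 4 / euler_fun (q ^ 9)"
    using euler_fun_mult_cube_roots[OF q(2) w] nz[of 9] by (simp add: field_simps)
  have p2: "euler_fun (q ^ 2) * euler_fun (w ^ 2 * q ^ 2) * euler_fun ((w ^ 2) ^ 2 * q ^ 2)
      = euler_fun (q ^ 6) ^ 4 / euler_fun (q ^ 18)"
    using euler_fun_mult_cube_roots[OF norm_power_less_one[OF q(2), of 2] w2] nz[of 18]
    by (simp add: field_simps flip: power_mult)
  have "(euler_fun (q ^ 6) ^ 4 / euler_fun (q ^ 18)) ^ 2 / (euler_fun (q ^ 3) ^ 4 / euler_fun (q ^ 9))
    = (euler_fun (q ^ 2) ^ 2 / euler_fun q) * (euler_fun (w ^ 2 * q ^ 2) ^ 2 / euler_fun (w * q))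
      * (euler_fun ((w ^ 2) ^ 2 * q ^ 2) ^ 2 / euler_fun (w ^ 2 * q))"
    unfolding p1[symmetric] p2[symmetric] by (simp only: power_mult_distrib times_divide_times_eq)
  also have "\<dots> = (q * A / ?y * (?y + 1)) * (q * A / ?y * (w * ?y + 1)) * (q * A / ?y * (w ^ 2 * ?y + 1))"
  proof -
    have "(w ^ 2) ^ 3 = 1" using w3 by algebra
    then show ?thesis
      using A[of 1] A[of w] A[of "w ^ 2"] w3 nw by (simp only: norm_power) simp
  qed
  also have "\<dots> = (q * A / ?y) ^ 3 * (1 + ?y ^ 3)"
    using w w3 by algebra
  also have "\<dots> = A ^ 3 * (q ^ 3 * (1 + 1 / ?y ^ 3))"
    using y0 by (simp add: field_simps)
  finally have "q ^ 3 * (1 + 1 / ?y ^ 3)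
      = (euler_fun (q ^ 6) ^ 4 / euler_fun (q ^ 18)) ^ 2 / (euler_fun (q ^ 3) ^ 4 / euler_fun (q ^ 9)) / A ^ 3"
    using nz[of 9] nz[of 18] by (simp add: A_def)
  also have "\<dots> = (euler_fun (q ^ 6) ^ 2 * euler_fun (q ^ 9) / (euler_fun (q ^ 3) * euler_fun (q ^ 18) ^ 2)) ^ 4"
    using nz[of 3] nz[of 9] nz[of 18] unfolding A_def by (simp add: divide_simps) algebra
  finally show ?thesis by simp
qed

section \<open>The modular equation\<close>

text \<open>The modular equation with denominators cleared, where \<open>u / v\<close> stands for
  \<open>P * Q\<close>: the difference of the sides is a multiple of the curve equation.\<close>

lemma curve_identity:
  fixes x y :: complex
  assumes "x - y = 2 * x ^ 2 * y ^ 2"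
  defines "u \<equiv> (1 - 2 * y) * x" and "v \<equiv> 1 - x"
  shows "(v ^ 2 - u ^ 2) ^ 2 * ((1 + x + x ^ 2) * (1 + 2 * y + 4 * y ^ 2))
    = ((1 - 2 * y) * (1 + x + x ^ 2) + x * (1 - x) * (1 + 2 * y + 4 * y ^ 2)) ^ 2 * (v ^ 2 + u * v + u ^ 2)"
  using assms(1) unfolding u_def v_def by algebra

text \<open>In terms of \<open>X = P * Q\<close> and \<open>w = P ^ 2 / Q ^ 2\<close> the claim is
  \<open>(1 / X + X) ^ 2 - 4 = (w + 1) ^ 2 / w * (1 / X + X + 1)\<close>, so only
  \<open>P * Q\<close> and \<open>Q ^ 4\<close> matter.\<close>

lemma modular_equation_of_curve:
  fixes x y P Q :: complex
  assumes curve: "x - y = 2 * x ^ 2 * y ^ 2"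
    and PQ: "P * Q = (1 - 2 * y) * x / (1 - x)"
    and Q: "Q ^ 4 = (1 - 8 * y ^ 3) * x ^ 3 / (1 - x ^ 3)"
    and nz: "P \<noteq> 0" "Q \<noteq> 0"
  shows "(1 / (P * Q) + P * Q) ^ 2 = (P / Q + Q / P) ^ 2 * (1 / (P * Q) + P * Q + 1) + 4"
proof -
  define u where "u = (1 - 2 * y) * x"
  define v where "v = 1 - x"
  define g where "g = 1 + x + x ^ 2"
  define h where "h = 1 + 2 * y + 4 * y ^ 2"
  have f: "1 - x ^ 3 = v * g" "1 - 8 * y ^ 3 = (1 - 2 * y) * h"
    unfolding v_def g_def h_def by algebra+
  have "P * Q \<noteq> 0" "Q ^ 4 \<noteq> 0" using nz by auto
  \<comment> \<open>Division by zero yields zero, so a nonzero quotient forces its denominator to be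
    nonzero as well.\<close>
  then have nz': "x \<noteq> 0" "1 - 2 * y \<noteq> 0" "v \<noteq> 0" "g \<noteq> 0" "h \<noteq> 0" "u \<noteq> 0"
    unfolding PQ Q f by (auto simp: v_def u_def)
  define X where "X = P * Q"
  define w where "w = P ^ 2 / Q ^ 2"
  have X: "X = u / v" by (simp add: X_def PQ u_def v_def)
  have "w = X ^ 2 / Q ^ 4" using nz by (simp add: w_def X_def field_simps flip: power_add)
  also have "\<dots> = (1 - 2 * y) * g / (x * v * h)"
    unfolding Q f X u_def using nz' by (simp add: divide_simps) algebra
  finally have w: "w = (1 - 2 * y) * g / (x * v * h)" .
  have K: "(v ^ 2 - u ^ 2) ^ 2 * (g * h) = ((1 - 2 * y) * g + x * v * h) ^ 2 * (v ^ 2 + u * v + u ^ 2)"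
    using curve_identity[OF curve] by (simp only: u_def v_def g_def h_def)
  have "X \<noteq> 0" "w \<noteq> 0" using nz by (auto simp: X_def w_def)
  have 1: "(1 / X + X) ^ 2 - 4 = (v ^ 2 - u ^ 2) ^ 2 / (u * v) ^ 2"
    unfolding X using nz' by (simp add: divide_simps) algebra
  have 2: "(P / Q + Q / P) ^ 2 = (w + 1) ^ 2 / w"
    unfolding w_def using nz by (simp add: divide_simps) algebra
  have 3: "(w + 1) ^ 2 / w = ((1 - 2 * y) * g + x * v * h) ^ 2 / (u * v * (g * h))"
    unfolding w u_def using nz' by (simp add: divide_simps) algebra
  have 4: "1 / X + X + 1 = (v ^ 2 + u * v + u ^ 2) / (u * v)"
    unfolding X using nz' by (simp add: divide_simps) algebra
  have "(1 / X + X) ^ 2 - 4 = (v ^ 2 - u ^ 2) ^ 2 * (g * h) / ((u * v) ^ 2 * (g * h))"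
    unfolding 1 using nz' by simp
  also have "\<dots> = (P / Q + Q / P) ^ 2 * (1 / X + X + 1)"
    unfolding 2 3 4 K using nz' by (simp add: power2_eq_square)
  finally show ?thesis unfolding X_def by (simp add: algebra_simps)
qed

lemma euler_fun_minus_power:
  assumes "norm q < 1" "n > 0"
  shows "euler_fun (- (q ^ n)) = euler_fun (q ^ (2 * n)) ^ 3 / (euler_fun (q ^ n) * euler_fun (q ^ (4 * n)))"
proof -
  have "euler_fun (q ^ n) \<noteq> 0" "euler_fun (q ^ (4 * n)) \<noteq> 0"
    using assms by (auto intro!: euler_fun_nonzero norm_power_less_one)
  with euler_fun_minus[OF norm_power_less_one[OF assms]] show ?thesis
    by (simp add: field_simps flip: power_mult)
qed

theorem theorem3p2:
  fixes q r P Q :: complex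
  assumes q: "0 < norm q" "norm q < 1"
    and r: "r ^ 8 = q"
    and P: "P = r ^ 2 * ramanujan_f (- q) * ramanujan_f (- (q ^ 12)) /
                (ramanujan_f (- (q ^ 3)) * ramanujan_f (- (q ^ 4)))"
    and Q: "Q = r ^ 6 * ramanujan_f (- (q ^ 3)) * ramanujan_f (- (q ^ 36)) /
                (ramanujan_f (- (q ^ 9)) * ramanujan_f (- (q ^ 12)))"
  shows "(1 / (P * Q) + P * Q) ^ 2 =
         (P / Q + Q / P) ^ 2 * (1 / (P * Q) + P * Q + 1) + 4"
proof -
  define e where "e = (\<lambda>n. euler_fun (q ^ n))"
  have q0: "q \<noteq> 0" and r0: "r \<noteq> 0" using q r by auto
  have nz: "e n \<noteq> 0" if "n > 0" for n
    unfolding e_def using q that by (intro euler_fun_nonzero norm_power_less_one)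
  note nz_e = nz[of 1] nz[of 2] nz[of 3] nz[of 4] nz[of 6] nz[of 9] nz[of 12] nz[of 18] nz[of 36]
  have f: "ramanujan_f (- (q ^ n)) = e n" for n
    by (simp add: ramanujan_f_def e_def euler_fun_def)
  have P': "P = r ^ 2 * e 1 * e 12 / (e 3 * e 4)" and Q': "Q = r ^ 6 * e 3 * e 36 / (e 9 * e 12)"
    using f[of 1] by (simp_all add: P Q f)
  have minus: "euler_fun (- q) = e 2 ^ 3 / (e 1 * e 4)"
    "euler_fun (- (q ^ 3)) = e 6 ^ 3 / (e 3 * e 12)"
    "euler_fun (- (q ^ 9)) = e 18 ^ 3 / (e 9 * e 36)"
    using euler_fun_minus_power[OF q(2), of 1] euler_fun_minus_power[OF q(2), of 3]
      euler_fun_minus_power[OF q(2), of 9] by (simp_all add: e_def)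
  have q': "0 < norm (- q)" "norm (- q) < 1" "0 < norm (q ^ 2)" "norm (q ^ 2) < 1"
    using q q0 norm_power_less_one[OF q(2), of 2] by auto

  define y where "y = eta_quot q"
  \<comment> \<open>\<open>x\<close> carries the dissections at \<open>- q\<close>; the
    \<open>minus\<close> equations rewrite it with positive arguments only.\<close>
  define x where "x = - eta_quot (- q)"
  define z where "z = eta_quot (q ^ 2)"
  have y: "y = q * e 3 * e 18 ^ 3 / (e 6 * e 9 ^ 3)"
    by (simp add: y_def eta_quot_def e_def)
  have x: "x = q * e 6 ^ 2 * e 9 ^ 3 * e 36 ^ 3 / (e 3 * e 12 * e 18 ^ 6)"
  proof -
    have "x = q * (e 6 ^ 3 / (e 3 * e 12)) * e 18 ^ 3 / (e 6 * (e 18 ^ 3 / (e 9 * e 36)) ^ 3)"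
      by (simp add: x_def eta_quot_def minus) (simp add: e_def)
    then show ?thesis using nz_e by (simp add: divide_simps) algebra
  qed
  have z: "z = q ^ 2 * e 6 * e 36 ^ 3 / (e 12 * e 18 ^ 3)"
    by (simp add: z_def eta_quot_def e_def flip: power_mult)
  have xyz: "x * y = z"
    unfolding x y z using nz_e by (simp add: divide_simps) algebra
  have x0: "x \<noteq> 0" unfolding x using nz_e q0 by simp

  have phi: "e 1 ^ 2 / e 2 = e 9 ^ 2 / e 18 * (1 - 2 * y)"
    using phi_dissect[OF q] by (simp add: e_def y_def)
  have phi_minus: "(e 2 ^ 3 / (e 1 * e 4)) ^ 2 / e 2 = (e 18 ^ 3 / (e 9 * e 36)) ^ 2 / e 18 * (1 + 2 * x)"
    using phi_dissect[OF q'(1,2)] by (simp add: minus x_def) (simp add: e_def)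
  have phi_sq: "e 2 ^ 2 / e 4 = e 18 ^ 2 / e 36 * (1 - 2 * z)"
    using phi_dissect[OF q'(3,4)] by (simp add: e_def z_def flip: power_mult)
  have psi_minus: "e 2 ^ 2 / (e 2 ^ 3 / (e 1 * e 4)) = - q * (e 18 ^ 2 / (e 18 ^ 3 / (e 9 * e 36))) * (1 - 1 / x)"
    using psi_dissect[OF q'(1,2)] by (simp add: minus x_def) (simp add: e_def)
  have cubic: "(e 3 ^ 2 * e 18 / (e 6 * e 9 ^ 2)) ^ 4 = 1 - 8 * y ^ 3"
    using phi_cubic[OF q] by (simp add: e_def y_def)
  have cubic_minus: "(e 6 ^ 2 * (e 18 ^ 3 / (e 9 * e 36)) / (e 6 ^ 3 / (e 3 * e 12) * e 18 ^ 2)) ^ 4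
      = - (q ^ 3) * (1 - 1 / x ^ 3)"
    using psi_cubic[OF q'(1,2)] by (simp add: minus x_def) (simp add: e_def)

  \<comment> \<open>The factors built from \<open>x\<close>, \<open>y\<close> and \<open>z\<close>
    are now turned into monomials in \<open>q\<close> and the \<open>e n\<close>.\<close>
  have a: "1 - 2 * y = e 1 ^ 2 * e 18 / (e 2 * e 9 ^ 2)"
    using phi nz_e by (simp add: field_simps)
  have a': "1 + 2 * x = e 2 ^ 5 * e 9 ^ 2 * e 36 ^ 2 / (e 1 ^ 2 * e 4 ^ 2 * e 18 ^ 5)"
  proof -
    have "1 + 2 * x = (e 2 ^ 3 / (e 1 * e 4)) ^ 2 / e 2 / ((e 18 ^ 3 / (e 9 * e 36)) ^ 2 / e 18)"
      unfolding phi_minus using nz_e by simp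
    also have "\<dots> = e 2 ^ 5 * e 9 ^ 2 * e 36 ^ 2 / (e 1 ^ 2 * e 4 ^ 2 * e 18 ^ 5)"
      using nz_e by (simp add: divide_simps) algebra
    finally show ?thesis .
  qed
  have s: "1 - 2 * z = e 2 ^ 2 * e 36 / (e 4 * e 18 ^ 2)"
    using phi_sq nz_e by (simp add: field_simps)
  have b: "(1 - x) / x = e 1 * e 4 * e 18 / (q * e 2 * e 9 * e 36)"
  proof -
    have "(1 - x) / x = e 2 ^ 2 / (e 2 ^ 3 / (e 1 * e 4)) / (q * (e 18 ^ 2 / (e 18 ^ 3 / (e 9 * e 36))))"
      unfolding psi_minus using nz_e q0 x0 by (simp add: diff_divide_distrib)
    also have "\<dots> = e 1 * e 4 * e 18 / (q * e 2 * e 9 * e 36)"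
      using nz_e q0 by (simp add: divide_simps) algebra
    finally show ?thesis .
  qed
  have c: "(1 - x ^ 3) / x ^ 3 = (e 3 * e 12 * e 18 / (e 6 * e 9 * e 36)) ^ 4 / q ^ 3"
  proof -
    have "(1 - x ^ 3) / x ^ 3
        = (e 6 ^ 2 * (e 18 ^ 3 / (e 9 * e 36)) / (e 6 ^ 3 / (e 3 * e 12) * e 18 ^ 2)) ^ 4 / q ^ 3"
      unfolding cubic_minus using q0 x0 by (simp add: diff_divide_distrib)
    also have "\<dots> = (e 3 * e 12 * e 18 / (e 6 * e 9 * e 36)) ^ 4 / q ^ 3"
      using nz_e q0 by (simp add: divide_simps) algebra
    finally show ?thesis .
  qed

  \<comment> \<open>This is phi(-q) phi(q) = phi(-q^2)^2 divided by the same formula for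
    \<open>q ^ 9\<close>; with \<open>z = x * y\<close> it expands to the curve equation.\<close>
  have "(1 - 2 * y) * (1 + 2 * x) = (1 - 2 * z) ^ 2"
    unfolding a a' s using nz_e by (simp add: divide_simps) algebra
  then have "x - y = 2 * x ^ 2 * y ^ 2"
    unfolding xyz[symmetric] by algebra
  then show ?thesis
  proof (rule modular_equation_of_curve)
    \<comment> \<open>\<open>e 3\<close> and \<open>e 12\<close> cancel in the product, and the
      fractional powers combine to \<open>r ^ 8 = q\<close>.\<close>
    have "P * Q = r ^ 8 * e 1 * e 36 / (e 4 * e 9)"
      unfolding P' Q' using nz_e by (simp add: divide_simps)
    also have "\<dots> = (1 - 2 * y) / ((1 - x) / x)"
      unfolding r a b using nz_e q0 by (simp add: divide_simps) algebra
    finally show "P * Q = (1 - 2 * y) * x / (1 - x)" by simp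
    have "Q ^ 4 = (r ^ 8) ^ 3 * (e 3 * e 36 / (e 9 * e 12)) ^ 4"
      unfolding Q' by (simp add: power_divide power_mult_distrib flip: power_mult)
    also have "\<dots> = (1 - 8 * y ^ 3) / ((1 - x ^ 3) / x ^ 3)"
      unfolding r c cubic[symmetric] using nz_e q0 by (simp add: divide_simps)
    finally show "Q ^ 4 = (1 - 8 * y ^ 3) * x ^ 3 / (1 - x ^ 3)" by simp
    show "P \<noteq> 0" "Q \<noteq> 0" unfolding P' Q' using nz_e r0 by auto
  qed
qed

end
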